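(* Let $\{\mathcal{L}_J:V_D\to V_J\}_{\emptyset\neq J\subseteq D}$ be a family of linear operators, and define linear operators $\{\mathcal{H}_J:V_D\to V_J\}_{J\subseteq D}$ recursively by $$\mathcal{H}_\emptyset:=\mathbb{E},\qquad \mathcal{H}_J:=\Big(I-\sum_{J'\subsetneq J}\mathcal{H}_{J'}\Big)\circ\mathcal{L}_J\quad(\emptyset\neq J\subseteq D).$$ Consider the following properties of $\{\mathcal{H}_J\}$: (P1) $\mathcal{H}_\emptyset=\mathbb{E}$, and $\mathbb{E}\circ\mathcal{H}_J=0$ for all $J\neq\emptyset$; (P2) for all $J\subseteq D$, $g\in V_D$: if $\frac{\partial g}{\partial \mathbf{x}_J}=0$, then $\mathcal{H}_J(g)=0$; (P3) for all $J\subseteq D$, $g\in V_J$: $\big(\sum_{J'\subseteq J}\mathcal{H}_{J'}\big)(g)=g$; (P4) $\mathcal{H}_J\circ\mathcal{H}_J=\mathcal{H}_J$ for all $J\subseteq D$; (P5) $\mathcal{H}_{J'}\circ\mathcal{H}_J=0$ whenever $J'\neq J$; (P6) when all feature variables $X_1,\dots,X_d$ are independent, $\sum_{J'\subseteq J}\mathcal{H}_{J'}=\mathbb{E}_{\mathbf{X}_{\setminus J}}$ for all $J\subseteq D$; and the following properties of $\{\mathcal{L}_J\}$, each for all nonempty $J\subseteq D$: (P2)* for all $g\in V_D$: if $\frac{\partial g}{\partial \mathbf{x}_J}=0$, then $\frac{\partial \mathcal{L}_J(g)}{\partial \mathbf{x}_J}=0$; (P3)* for all $g\in V_J$: $\frac{\partial}{\partial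 \mathbf{x}_J}(\mathcal{L}_J(g)-g)=0$; (P6)* when all feature variables are independent, $\frac{\partial}{\partial \mathbf{x}_J}(\mathcal{L}_J(g)-\mathbb{E}_{\mathbf{X}_{\setminus J}}(g))=0$ for all $g\in V_D$. Then: (1) (P1) always holds. (2) (P2)* and (P3)* together imply (P2) and (P3). (3) (P2) implies (P2)*. (4) (P3) implies (P3)*. (5) (P2) and (P3) together imply (P4) and (P5). (6) (P2), (P3) and (P6)* together imply (P6). (7) (P6) implies (P6)*.
   Context: Setting. Let $d\ge 1$, $D=\{1,\dots,d\}$, and let $\mathbf{X}_D=(X_1,\dots,X_d)$ be a random vector of real feature variables (possibly dependent), each $X_j$ having compactly supported distribution. Let $\mathcal{X}_j\subset\mathbb{R}$ be the nonempty compact set of values that the variable $x_j$ can take, with $X_j\in\mathcal{X}_j$. $V_D$ is the real vector space of bounded measurable functions $g$ on $\prod_{j\in D}\mathcal{X}_j$; for $J\subseteq D$, $V_J\subseteq V_D$ is the subspace of functions depending only on the variables $\mathbf{x}_J=(x_j)_{j\in J}$, and $V_\emptyset=\mathbb{R}$ (constants). Thus $V_{J'}\subseteq V_J$ if $J'\subseteq J$, and any operators $V_D\to V_J$ and $V_D\to V_{J'}$ can be composed (written $\circ$). Put $\setminus J:=D\setminus J$. Operators. $I$ is the identity of $V_D$; $\mathbb{E}:V_D\to\mathbb{R}$, $\mathbb{E}(g)=\mathbb{E}[g(\mathbf{X}_D)]$; $\mathbb{E}_{\mathbf{X}_{\setminus J}}:V_D\to V_J$, $\mathbb{E}_{\mathbf{X}_{\setminus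 J}}(g)(\mathbf{x}_J)=\mathbb{E}[g(\mathbf{x}_J,\mathbf{X}_{\setminus J})]$ (expectation over the marginal law of $\mathbf{X}_{\setminus J}$, with $\mathbf{x}_J$ fixed). Notation $\frac{\partial g}{\partial\mathbf{x}_J}=0$. Let $g|_{\mathbf{x}_J=\mathbf{c}}$ denote substitution of $\mathbf{c}$ for $\mathbf{x}_J$ in $g$, and put ${}_J\Delta_{\mathbf{a}_J}(g)=\sum_{J'\subseteq J}(-1)^{|J'|}g|_{\mathbf{x}_{J'}=\mathbf{a}_{J'}}$ (the composition over $j\in J$ of the operators $g\mapsto g-g|_{x_j=a_j}$). No differentiability is assumed: "$\frac{\partial g}{\partial \mathbf{x}_J}=0$" means by definition that ${}_J\Delta_{\mathbf{a}_J}(g)=0$ identically for every value $\mathbf{a}_J\in\prod_{j\in J}\mathcal{X}_j$. *)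

theory Defs
  imports "HOL-Probability.Probability"
begin

text \<open>
  A point of the product of the sets \<open>S j\<close> (\<open>j \<in> D\<close>) is an element of \<open>PiE D S\<close>.  A real function
  on that product is represented by its extension by zero to all of \<open>nat \<Rightarrow> real\<close>, so that the
  bounded measurable functions form a real vector space under the pointwise operations and two
  of them are equal as HOL functions iff they agree on the product.  In particular a constant is
  represented by a function that is constant on \<open>PiE D S\<close> and zero elsewhere.
\<close>

type_synonym rfun = "(nat \<Rightarrow> real) \<Rightarrow> real"

definition bmf :: "nat set \<Rightarrow> (nat \<Rightarrow> real set) \<Rightarrow> rfun set" where
  "bmf D S = {g. g \<in> borel_measurable (PiM D (\<lambda>j. restrict_space borel (S j))) \<and>
                 bounded (g ` PiE D S) \<and>
                 (\<forall>x. x \<notin> PiE D S \<longrightarrow> g x = 0)}"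

definition bmf_dep :: "nat set \<Rightarrow> (nat \<Rightarrow> real set) \<Rightarrow> nat set \<Rightarrow> rfun set" where
  "bmf_dep D S J = {g \<in> bmf D S.
     \<forall>x\<in>PiE D S. \<forall>y\<in>PiE D S. (\<forall>j\<in>J. x j = y j) \<longrightarrow> g x = g y}"

definition linear_operator :: "rfun set \<Rightarrow> rfun set \<Rightarrow> (rfun \<Rightarrow> rfun) \<Rightarrow> bool" where
  "linear_operator V W T \<longleftrightarrow>
     (\<forall>g\<in>V. T g \<in> W) \<and>
     (\<forall>g\<in>V. \<forall>h\<in>V. T (\<lambda>x. g x + h x) = (\<lambda>x. T g x + T h x)) \<and>
     (\<forall>c. \<forall>g\<in>V. T (\<lambda>x. c * g x) = (\<lambda>x. c * T g x))"

definition expect_op ::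
  "'a measure \<Rightarrow> (nat \<Rightarrow> 'a \<Rightarrow> real) \<Rightarrow> nat set \<Rightarrow> (nat \<Rightarrow> real set) \<Rightarrow> rfun \<Rightarrow> rfun" where
  "expect_op M X D S g =
     (\<lambda>x. if x \<in> PiE D S then (\<integral>\<omega>. g (\<lambda>j\<in>D. X j \<omega>) \<partial>M) else 0)"

text \<open>The subscript \<open>J\<close> is the set of variables that are kept fixed; those in \<open>D - J\<close> are
  averaged out.\<close>

definition marg_expect_op ::
  "'a measure \<Rightarrow> (nat \<Rightarrow> 'a \<Rightarrow> real) \<Rightarrow> nat set \<Rightarrow> (nat \<Rightarrow> real set) \<Rightarrow> nat set \<Rightarrow> rfun \<Rightarrow> rfun" where
  "marg_expect_op M X D S J g =
     (\<lambda>x. if x \<in> PiE D S then (\<integral>\<omega>. g (override_on (\<lambda>j\<in>D. X j \<omega>) x J) \<partial>M) else 0)"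

definition subst_vars :: "nat set \<Rightarrow> (nat \<Rightarrow> real) \<Rightarrow> rfun \<Rightarrow> rfun" where
  "subst_vars J c g = (\<lambda>x. g (override_on x c J))"

definition delta :: "nat set \<Rightarrow> (nat \<Rightarrow> real) \<Rightarrow> rfun \<Rightarrow> rfun" where
  "delta J a g = (\<lambda>x. \<Sum>J'\<in>Pow J. (-1) ^ card J' * subst_vars J' a g x)"

text \<open>The derivative-free meaning of \<open>\<partial>g / \<partial>x\<^sub>J = 0\<close>.\<close>

definition deriv_zero :: "nat set \<Rightarrow> (nat \<Rightarrow> real set) \<Rightarrow> nat set \<Rightarrow> rfun \<Rightarrow> bool" where
  "deriv_zero D S J g \<longleftrightarrow> (\<forall>a\<in>PiE J S. \<forall>x\<in>PiE D S. delta J a g x = 0)"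

text \<open>The recursion is over finite \<open>J\<close>; the value for infinite \<open>J\<close> is a dummy.\<close>

function H_op ::
  "'a measure \<Rightarrow> (nat \<Rightarrow> 'a \<Rightarrow> real) \<Rightarrow> nat set \<Rightarrow> (nat \<Rightarrow> real set) \<Rightarrow>
   (nat set \<Rightarrow> rfun \<Rightarrow> rfun) \<Rightarrow> nat set \<Rightarrow> rfun \<Rightarrow> rfun" where
  "H_op M X D S L J g =
     (if infinite J then (\<lambda>_. 0)
      else if J = {} then expect_op M X D S g
      else (\<lambda>x. L J g x - (\<Sum>J'\<in>{J'. J' \<subset> J}. H_op M X D S L J' (L J g) x)))"
  by pat_completeness auto
termination
  by (relation "Wellfounded.measure (\<lambda>(M, X, D, S, L, J, g). card J)") (auto intro: psubset_card_mono)

declare H_op.simps [simp del]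

definition P1 ::
  "'a measure \<Rightarrow> (nat \<Rightarrow> 'a \<Rightarrow> real) \<Rightarrow> nat set \<Rightarrow> (nat \<Rightarrow> real set) \<Rightarrow>
   (nat set \<Rightarrow> rfun \<Rightarrow> rfun) \<Rightarrow> bool" where
  "P1 M X D S H \<longleftrightarrow>
     (\<forall>g\<in>bmf D S. H {} g = expect_op M X D S g) \<and>
     (\<forall>J\<subseteq>D. J \<noteq> {} \<longrightarrow> (\<forall>g\<in>bmf D S. expect_op M X D S (H J g) = (\<lambda>_. 0)))"

definition P2 :: "nat set \<Rightarrow> (nat \<Rightarrow> real set) \<Rightarrow> (nat set \<Rightarrow> rfun \<Rightarrow> rfun) \<Rightarrow> bool" where
  "P2 D S H \<longleftrightarrow> (\<forall>J\<subseteq>D. \<forall>g\<in>bmf D S. deriv_zero D S J g \<longrightarrow> H J g = (\<lambda>_. 0))"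

definition P3 :: "nat set \<Rightarrow> (nat \<Rightarrow> real set) \<Rightarrow> (nat set \<Rightarrow> rfun \<Rightarrow> rfun) \<Rightarrow> bool" where
  "P3 D S H \<longleftrightarrow> (\<forall>J\<subseteq>D. \<forall>g\<in>bmf_dep D S J. (\<lambda>x. \<Sum>J'\<in>Pow J. H J' g x) = g)"

definition P4 :: "nat set \<Rightarrow> (nat \<Rightarrow> real set) \<Rightarrow> (nat set \<Rightarrow> rfun \<Rightarrow> rfun) \<Rightarrow> bool" where
  "P4 D S H \<longleftrightarrow> (\<forall>J\<subseteq>D. \<forall>g\<in>bmf D S. H J (H J g) = H J g)"

definition P5 :: "nat set \<Rightarrow> (nat \<Rightarrow> real set) \<Rightarrow> (nat set \<Rightarrow> rfun \<Rightarrow> rfun) \<Rightarrow> bool" where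
  "P5 D S H \<longleftrightarrow>
     (\<forall>J\<subseteq>D. \<forall>J'\<subseteq>D. J' \<noteq> J \<longrightarrow> (\<forall>g\<in>bmf D S. H J' (H J g) = (\<lambda>_. 0)))"

definition P6 ::
  "'a measure \<Rightarrow> (nat \<Rightarrow> 'a \<Rightarrow> real) \<Rightarrow> nat set \<Rightarrow> (nat \<Rightarrow> real set) \<Rightarrow>
   (nat set \<Rightarrow> rfun \<Rightarrow> rfun) \<Rightarrow> bool" where
  "P6 M X D S H \<longleftrightarrow>
     (prob_space.indep_vars M (\<lambda>_. borel) X D \<longrightarrow>
       (\<forall>J\<subseteq>D. \<forall>g\<in>bmf D S. (\<lambda>x. \<Sum>J'\<in>Pow J. H J' g x) = marg_expect_op M X D S J g))"

definition P2_star :: "nat set \<Rightarrow> (nat \<Rightarrow> real set) \<Rightarrow> (nat set \<Rightarrow> rfun \<Rightarrow> rfun) \<Rightarrow> bool" where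
  "P2_star D S L \<longleftrightarrow>
     (\<forall>J\<subseteq>D. J \<noteq> {} \<longrightarrow>
       (\<forall>g\<in>bmf D S. deriv_zero D S J g \<longrightarrow> deriv_zero D S J (L J g)))"

definition P3_star :: "nat set \<Rightarrow> (nat \<Rightarrow> real set) \<Rightarrow> (nat set \<Rightarrow> rfun \<Rightarrow> rfun) \<Rightarrow> bool" where
  "P3_star D S L \<longleftrightarrow>
     (\<forall>J\<subseteq>D. J \<noteq> {} \<longrightarrow>
       (\<forall>g\<in>bmf_dep D S J. deriv_zero D S J (\<lambda>x. L J g x - g x)))"

definition P6_star ::
  "'a measure \<Rightarrow> (nat \<Rightarrow> 'a \<Rightarrow> real) \<Rightarrow> nat set \<Rightarrow> (nat \<Rightarrow> real set) \<Rightarrow>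
   (nat set \<Rightarrow> rfun \<Rightarrow> rfun) \<Rightarrow> bool" where
  "P6_star M X D S L \<longleftrightarrow>
     (prob_space.indep_vars M (\<lambda>_. borel) X D \<longrightarrow>
       (\<forall>J\<subseteq>D. J \<noteq> {} \<longrightarrow>
         (\<forall>g\<in>bmf D S. deriv_zero D S J (\<lambda>x. L J g x - marg_expect_op M X D S J g x))))"

end

theory Submission imports Defs begin

text \<open>
  A function in \<open>V\<^sub>J\<close> has vanishing mixed difference over \<open>J\<close> iff it is a sum of functions
  in \<open>V\<^sub>K\<close> with \<open>K \<subset> J\<close>: such sums vanish under the difference by pairing the subsets with and
  without a missing variable, and conversely fixing a point \<open>a\<close> expands the function through its
  proper substitutions.  Hence, if (P2) and (P3) hold below \<open>J\<close>, the operator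
  \<open>I - (\<Sum>K\<subset>J. H\<^sub>K)\<close> kills exactly the functions of \<open>V\<^sub>J\<close> with vanishing difference, which
  transfers information between \<open>L\<^sub>J\<close> and \<open>H\<^sub>J\<close>; all claims then follow by induction on \<open>J\<close>.
  For (P6) one also needs the tower rule for the marginal expectations under independence, which
  by Moebius inversion gives that \<open>H\<^sub>K\<close> does not see the averaging over \<open>D - J\<close> for \<open>K \<subset> J\<close>.
\<close>

section \<open>Functions depending on a subset of the variables\<close>

abbreviation feature_space :: "nat set \<Rightarrow> (nat \<Rightarrow> real set) \<Rightarrow> (nat \<Rightarrow> real) measure" where
  "feature_space D S \<equiv> PiM D (\<lambda>j. restrict_space borel (S j))"

lemma space_feature_space: "space (feature_space D S) = PiE D S"
  by (simp add: space_PiM space_restrict_space)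

lemma bmfI:
  assumes "g \<in> borel_measurable (feature_space D S)"
    and "\<And>x. x \<in> PiE D S \<Longrightarrow> \<bar>g x\<bar> \<le> B"
    and "\<And>x. x \<notin> PiE D S \<Longrightarrow> g x = 0"
  shows "g \<in> bmf D S"
  using assms unfolding bmf_def bounded_iff by auto

lemma bmfE:
  assumes "g \<in> bmf D S"
  obtains B where "g \<in> borel_measurable (feature_space D S)" "\<And>x. \<bar>g x\<bar> \<le> B"
    "\<And>x. x \<notin> PiE D S \<Longrightarrow> g x = 0"
proof -
  from assms obtain B where B: "\<And>x. x \<in> PiE D S \<Longrightarrow> \<bar>g x\<bar> \<le> B"
    unfolding bmf_def bounded_iff by fastforce
  \<comment> \<open>Off the product \<open>g\<close> is 0; the maximum guards against a negative
    \<open>B\<close>, possible when the product is empty.\<close>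
  have "\<bar>g x\<bar> \<le> max B 0" for x
    using B[of x] assms by (cases "x \<in> PiE D S") (auto simp: bmf_def)
  with assms show ?thesis by (intro that[of "max B 0"]) (auto simp: bmf_def)
qed

lemma bmf_dep_in_bmf: "g \<in> bmf_dep D S J \<Longrightarrow> g \<in> bmf D S"
  by (simp add: bmf_dep_def)

text \<open>Points of \<open>PiE D S\<close> are extensional, so agreement on \<open>D\<close> is
  equality. Facts about V_J thus specialise to V_D.\<close>

lemma bmf_dep_all: "bmf_dep D S D = bmf D S"
proof -
  have "x = y" if "x \<in> PiE D S" "y \<in> PiE D S" "\<forall>j\<in>D. x j = y j" for x y
    using that by (intro PiE_ext[of x D S y]) auto
  then show ?thesis by (auto simp: bmf_dep_def)
qed

lemma bmf_dep_mono:
  assumes "K \<subseteq> J" shows "bmf_dep D S K \<subseteq> bmf_dep D S J"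
  unfolding bmf_dep_def using assms by blast

lemma bmf_dep_outside: "g \<in> bmf_dep D S J \<Longrightarrow> x \<notin> PiE D S \<Longrightarrow> g x = 0"
  by (auto simp: bmf_dep_def bmf_def)

lemma bmf_dep_cong:
  assumes "g \<in> bmf_dep D S J" "x \<in> PiE D S" "y \<in> PiE D S" "\<And>j. j \<in> J \<Longrightarrow> x j = y j"
  shows "g x = g y"
  using assms unfolding bmf_dep_def mem_Collect_eq by blast

lemma bmf_depI:
  assumes "g \<in> bmf D S"
    and "\<And>x y. x \<in> PiE D S \<Longrightarrow> y \<in> PiE D S \<Longrightarrow> (\<And>j. j \<in> J \<Longrightarrow> x j = y j) \<Longrightarrow> g x = g y"
  shows "g \<in> bmf_dep D S J"
  unfolding bmf_dep_def using assms by blast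

lemma bmf_dep_zero: "(\<lambda>_. 0) \<in> bmf_dep D S J"
  by (auto simp: bmf_dep_def intro: bmfI[where B = 0])

lemma bmf_dep_add:
  assumes "g \<in> bmf_dep D S J" "h \<in> bmf_dep D S J"
  shows "(\<lambda>x. g x + h x) \<in> bmf_dep D S J"
proof -
  obtain A where A: "g \<in> borel_measurable (feature_space D S)" "\<And>x. \<bar>g x\<bar> \<le> A"
      "\<And>x. x \<notin> PiE D S \<Longrightarrow> g x = 0"
    using bmfE[OF bmf_dep_in_bmf[OF assms(1)]] by metis
  obtain B where B: "h \<in> borel_measurable (feature_space D S)" "\<And>x. \<bar>h x\<bar> \<le> B"
      "\<And>x. x \<notin> PiE D S \<Longrightarrow> h x = 0"
    using bmfE[OF bmf_dep_in_bmf[OF assms(2)]] by metis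
  have "\<bar>g x + h x\<bar> \<le> A + B" for x
    using A(2)[of x] B(2)[of x] by linarith
  then have "(\<lambda>x. g x + h x) \<in> bmf D S"
    using A B by (intro bmfI[where B = "A + B"]) auto
  then show ?thesis
    by (intro bmf_depI arg_cong2[of _ _ _ _ plus] bmf_dep_cong[OF assms(1)] bmf_dep_cong[OF assms(2)])
qed

lemma bmf_dep_cmult:
  assumes "g \<in> bmf_dep D S J"
  shows "(\<lambda>x. c * g x) \<in> bmf_dep D S J"
proof -
  obtain A where A: "g \<in> borel_measurable (feature_space D S)" "\<And>x. \<bar>g x\<bar> \<le> A"
      "\<And>x. x \<notin> PiE D S \<Longrightarrow> g x = 0"
    using bmfE[OF bmf_dep_in_bmf[OF assms]] by metis
  have "\<bar>c * g x\<bar> \<le> \<bar>c\<bar> * A" for x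
    using A(2)[of x] by (simp add: abs_mult mult_left_mono)
  then have "(\<lambda>x. c * g x) \<in> bmf D S"
    using A by (intro bmfI[where B = "\<bar>c\<bar> * A"]) auto
  then show ?thesis
    by (intro bmf_depI arg_cong[of _ _ "times c"] bmf_dep_cong[OF assms])
qed

lemma bmf_dep_diff:
  assumes "g \<in> bmf_dep D S J" "h \<in> bmf_dep D S J"
  shows "(\<lambda>x. g x - h x) \<in> bmf_dep D S J"
  using bmf_dep_add[OF assms(1) bmf_dep_cmult[OF assms(2), of "-1"]] by simp

lemma bmf_dep_sum:
  assumes "\<And>i. i \<in> A \<Longrightarrow> f i \<in> bmf_dep D S J"
  shows "(\<lambda>x. \<Sum>i\<in>A. f i x) \<in> bmf_dep D S J"
proof (cases "finite A")
  case True
  then show ?thesis using assms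
    by (induction A) (auto intro: bmf_dep_zero bmf_dep_add)
qed (auto intro: bmf_dep_zero)

lemmas bmf_sum = bmf_dep_sum[of _ _ D S D for D S, unfolded bmf_dep_all]

section \<open>Linear operators on bounded measurable functions\<close>

lemma linear_operatorD:
  assumes "linear_operator V W T"
  shows "g \<in> V \<Longrightarrow> T g \<in> W"
    and "g \<in> V \<Longrightarrow> h \<in> V \<Longrightarrow> T (\<lambda>x. g x + h x) = (\<lambda>x. T g x + T h x)"
    and "g \<in> V \<Longrightarrow> T (\<lambda>x. c * g x) = (\<lambda>x. c * T g x)"
  using assms unfolding linear_operator_def by auto

lemma linear_operator_zero:
  assumes "linear_operator (bmf D S) W T"
  shows "T (\<lambda>_. 0) = (\<lambda>_. 0)"
  using linear_operatorD(3)[OF assms, of "\<lambda>_. 0" 0] bmf_dep_zero[of D S D]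
  by (simp add: bmf_dep_all)

lemma linear_operator_diff:
  assumes "linear_operator (bmf D S) W T" "g \<in> bmf D S" "h \<in> bmf D S"
  shows "T (\<lambda>x. g x - h x) = (\<lambda>x. T g x - T h x)"
proof -
  have "(\<lambda>x. (-1) * h x) \<in> bmf D S"
    using bmf_dep_cmult[of h D S D] assms(3) by (simp only: bmf_dep_all)
  from linear_operatorD(2)[OF assms(1,2) this] linear_operatorD(3)[OF assms(1,3), of "-1"]
  show ?thesis by simp
qed

lemma linear_operator_sum:
  assumes "linear_operator (bmf D S) W T" "\<And>i. i \<in> A \<Longrightarrow> f i \<in> bmf D S"
  shows "T (\<lambda>x. \<Sum>i\<in>A. f i x) = (\<lambda>x. \<Sum>i\<in>A. T (f i) x)"
proof (cases "finite A")
  case True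
  then show ?thesis using assms(2)
  proof (induction A)
    case empty
    then show ?case using linear_operator_zero[OF assms(1)] by simp
  next
    case (insert i A)
    have "(\<lambda>x. \<Sum>i\<in>A. f i x) \<in> bmf D S"
      using insert.prems by (intro bmf_sum) auto
    then have "T (\<lambda>x. f i x + (\<Sum>i\<in>A. f i x)) = (\<lambda>x. T (f i) x + T (\<lambda>x. \<Sum>i\<in>A. f i x) x)"
      using insert.prems by (intro linear_operatorD(2)[OF assms(1)]) auto
    moreover have "T (\<lambda>x. \<Sum>i\<in>A. f i x) = (\<lambda>x. \<Sum>i\<in>A. T (f i) x)"
      using insert.prems by (intro insert.IH) auto
    ultimately show ?case
      by (simp only: sum.insert[OF insert.hyps])
  qed
qed (use linear_operator_zero[OF assms(1)] in simp)

section \<open>Vanishing mixed differences\<close>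

lemma override_on_PiE:
  assumes "x \<in> PiE D S" "\<And>j. j \<in> J \<Longrightarrow> a j \<in> S j" "J \<subseteq> D"
  shows "override_on x a J \<in> PiE D S"
  using assms by (fastforce simp: override_on_def PiE_iff extensional_def)

text \<open>The sets \<open>K\<close> and \<open>insert j K\<close> pair up with equal values of
  \<open>f\<close> and opposite signs.\<close>

lemma sum_Pow_alternating_zero:
  fixes f :: "'b set \<Rightarrow> real"
  assumes "finite J" "j \<in> J" "\<And>K. K \<subseteq> J - {j} \<Longrightarrow> f (insert j K) = f K"
  shows "(\<Sum>K\<in>Pow J. (-1) ^ card K * f K) = 0"
proof -
  define I where "I = J - {j}"
  have I: "finite I" "j \<notin> I" "J = insert j I"
    using assms by (auto simp: I_def)
  have inj: "inj_on (insert j) (Pow I)"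
    using I(2) by (auto simp: inj_on_def)
  have "(\<Sum>K\<in>Pow J. (-1) ^ card K * f K) =
      (\<Sum>K\<in>Pow I. (-1) ^ card K * f K) + (\<Sum>K\<in>insert j ` Pow I. (-1) ^ card K * f K)"
    unfolding I(3) Pow_insert using I by (intro sum.union_disjoint) auto
  also have "(\<Sum>K\<in>insert j ` Pow I. (-1) ^ card K * f K) =
      (\<Sum>K\<in>Pow I. - ((-1) ^ card K * f K))"
    unfolding sum.reindex[OF inj]
  proof (rule sum.cong)
    fix K assume "K \<in> Pow I"
    then have "finite K" "j \<notin> K" "f (insert j K) = f K"
      using I(1,2) assms(3)[of K] finite_subset[of K I] by (auto simp: I_def)
    then show "((\<lambda>K. (-1) ^ card K * f K) \<circ> insert j) K = - ((-1) ^ card K * f K)"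
      by simp
  qed simp
  finally show ?thesis by (simp add: sum_negf)
qed

text \<open>An index of \<open>J\<close> outside \<open>K\<close> is invisible to \<open>g\<close>,
  so substituting for it changes nothing and the alternating sum cancels in pairs. \<open>K\<close>
  may contain indices outside \<open>J\<close>, as \<open>H_unrelated\<close> requires.\<close>

lemma deriv_zero_bmf_dep:
  assumes "finite D" "J \<subseteq> D" "\<not> J \<subseteq> K" "g \<in> bmf_dep D S K"
  shows "deriv_zero D S J g"
  unfolding deriv_zero_def delta_def subst_vars_def
proof (intro ballI)
  fix a x assume a: "a \<in> PiE J S" and x: "x \<in> PiE D S"
  obtain j where j: "j \<in> J" "j \<notin> K" using assms(3) by auto
  have "g (override_on x a (insert j J')) = g (override_on x a J')" if "J' \<subseteq> J - {j}" for J'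
  proof (rule bmf_dep_cong[OF assms(4)])
    have aS: "\<And>i. i \<in> J \<Longrightarrow> a i \<in> S i" using a by auto
    show "override_on x a (insert j J') \<in> PiE D S" "override_on x a J' \<in> PiE D S"
      by (rule override_on_PiE[OF x]; use that aS j assms(2) in blast)+
  qed (use j in \<open>auto simp: override_on_def\<close>)
  then show "(\<Sum>J'\<in>Pow J. (-1) ^ card J' * g (override_on x a J')) = 0"
    using finite_subset[OF assms(2,1)] j by (intro sum_Pow_alternating_zero) auto
qed

lemma deriv_zero_sum:
  assumes "\<And>i. i \<in> A \<Longrightarrow> deriv_zero D S J (f i)"
  shows "deriv_zero D S J (\<lambda>x. \<Sum>i\<in>A. f i x)"
  unfolding deriv_zero_def
proof (intro ballI)
  fix a x assume "a \<in> PiE J S" "x \<in> PiE D S"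
  then have "(\<Sum>i\<in>A. delta J a (f i) x) = 0"
    using assms by (intro sum.neutral) (auto simp: deriv_zero_def)
  also have "(\<Sum>i\<in>A. delta J a (f i) x) = delta J a (\<lambda>x. \<Sum>i\<in>A. f i x) x"
    unfolding delta_def subst_vars_def sum_distrib_left by (rule sum.swap)
  finally show "delta J a (\<lambda>x. \<Sum>i\<in>A. f i x) x = 0" .
qed

lemma deriv_zero_sum_lower:
  assumes "finite D" "J \<subseteq> D" "\<And>K. K \<subset> J \<Longrightarrow> f K \<in> bmf_dep D S K"
  shows "deriv_zero D S J (\<lambda>x. \<Sum>K\<in>{K. K \<subset> J}. f K x)"
  using assms by (intro deriv_zero_sum deriv_zero_bmf_dep) auto

text \<open>\<open>\<phi>\<close> is controlled only on the product; the case distinction restores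
  the extension by zero.\<close>

lemma bmf_comp:
  assumes "g \<in> bmf D S" "\<phi> \<in> measurable (feature_space D S) (feature_space D S)"
  shows "(\<lambda>x. if x \<in> PiE D S then g (\<phi> x) else 0) \<in> bmf D S"
proof -
  obtain B where B: "g \<in> borel_measurable (feature_space D S)" "\<And>x. \<bar>g x\<bar> \<le> B"
    using bmfE[OF assms(1)] by metis
  have "(\<lambda>x. g (\<phi> x)) \<in> borel_measurable (feature_space D S)"
    using measurable_comp[OF assms(2) B(1)] by (simp add: comp_def)
  then have "(\<lambda>x. if x \<in> PiE D S then g (\<phi> x) else 0) \<in> borel_measurable (feature_space D S)"
    by (subst measurable_cong[where g = "\<lambda>x. g (\<phi> x)"]) (auto simp: space_feature_space)
  then show ?thesis using B(2) by (intro bmfI[where B = B]) auto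
qed

lemma measurable_feature_space:
  assumes "\<And>j. j \<in> D \<Longrightarrow> (\<lambda>\<omega>. f \<omega> j) \<in> measurable N (restrict_space borel (S j))"
    and "\<And>\<omega>. \<omega> \<in> space N \<Longrightarrow> f \<omega> \<in> PiE D S"
  shows "f \<in> measurable N (feature_space D S)"
  using measurable_PiM_single'[of D "\<lambda>j \<omega>. f \<omega> j" N "\<lambda>j. restrict_space borel (S j)"] assms
  by (auto simp: space_restrict_space)

text \<open>Overwriting the coordinates in \<open>K\<close> removes the dependence on them, and the
  values of \<open>a\<close> keep the overwritten point inside the product.\<close>

lemma subst_vars_bmf_dep:
  assumes "g \<in> bmf_dep D S J" "a \<in> PiE J S" "J \<subseteq> D" "K \<subseteq> J"
  shows "(\<lambda>x. if x \<in> PiE D S then subst_vars K a g x else 0) \<in> bmf_dep D S (J - K)"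
proof -
  have ov: "override_on x a K \<in> PiE D S" if "x \<in> PiE D S" for x
    using that assms by (intro override_on_PiE) auto
  have "(\<lambda>x. override_on x a K) \<in> measurable (feature_space D S) (feature_space D S)"
  proof (rule measurable_feature_space)
    fix j assume j: "j \<in> D"
    \<comment> \<open>Coordinate \<open>j\<close> of the map is either a constant or a
      projection.\<close>
    show "(\<lambda>x. override_on x a K j) \<in> measurable (feature_space D S) (restrict_space borel (S j))"
    proof (cases "j \<in> K")
      case True
      then have "a j \<in> space (restrict_space borel (S j))"
        using assms by (auto simp: space_restrict_space)
      with True show ?thesis by (simp add: override_on_def)
    next
      case False
      then show ?thesis using j by (simp add: override_on_def)
    qed
  qed (use ov in \<open>simp add: space_feature_space\<close>)
  from bmf_comp[OF bmf_dep_in_bmf[OF assms(1)] this]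
  have "(\<lambda>x. if x \<in> PiE D S then subst_vars K a g x else 0) \<in> bmf D S"
    unfolding subst_vars_def .
  then show ?thesis
  proof (rule bmf_depI)
    fix x y assume xy: "x \<in> PiE D S" "y \<in> PiE D S" "\<And>j. j \<in> J - K \<Longrightarrow> x j = y j"
    then have "subst_vars K a g x = subst_vars K a g y"
      unfolding subst_vars_def
      by (intro bmf_dep_cong[OF assms(1)] ov) (auto simp: override_on_def)
    with xy(1,2) show "(if x \<in> PiE D S then subst_vars K a g x else 0) =
        (if y \<in> PiE D S then subst_vars K a g y else 0)" by simp
  qed
qed

text \<open>Converse of \<open>deriv_zero_sum_lower\<close>. For a fixed base point
  \<open>a\<close>, the vanishing alternating sum is solved for its term without substitution, which
  is \<open>g\<close>; every other term has lost a variable of \<open>J\<close>.\<close>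

lemma deriv_zero_decompose:
  assumes "finite D" "J \<subseteq> D" "\<And>j. j \<in> D \<Longrightarrow> S j \<noteq> {}"
    and g: "g \<in> bmf_dep D S J" "deriv_zero D S J g"
  obtains f where "\<And>K. K \<subset> J \<Longrightarrow> f K \<in> bmf_dep D S K"
    "g = (\<lambda>x. \<Sum>K\<in>{K. K \<subset> J}. f K x)"
proof -
  have finJ: "finite J" using assms finite_subset by blast
  have "PiE J S \<noteq> {}" using assms by (auto simp: PiE_eq_empty_iff)
  then obtain a where a: "a \<in> PiE J S" by blast
  \<comment> \<open>The index is the set of variables that remain: substituting for
    \<open>J - K\<close> leaves a function of those in \<open>K\<close>. The leading minus comes
    from moving the term to the other side.\<close>
  define f where "f K = (\<lambda>x. - ((-1) ^ card (J - K)) *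
    (if x \<in> PiE D S then subst_vars (J - K) a g x else 0))" for K
  have "f K \<in> bmf_dep D S K" if "K \<subset> J" for K
  proof -
    have "J - (J - K) = K" using that by auto
    then show ?thesis unfolding f_def
      using subst_vars_bmf_dep[OF g(1) a assms(2), of "J - K"] by (intro bmf_dep_cmult) auto
  qed
  moreover have "g x = (\<Sum>K\<in>{K. K \<subset> J}. f K x)" for x
  proof (cases "x \<in> PiE D S")
    case True
    define t where "t K = (-1) ^ card K * subst_vars K a g x" for K
    have "0 = (\<Sum>K\<in>Pow J. t K)"
      using g(2) a True by (simp add: deriv_zero_def delta_def t_def)
    also have "\<dots> = t {} + (\<Sum>K\<in>Pow J - {{}}. t K)"
      using finJ by (intro sum.remove) auto
    also have "t {} = g x" by (simp add: t_def subst_vars_def)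
    \<comment> \<open>Complementation in \<open>J\<close> exchanges nonempty subsets and proper
      subsets.\<close>
    also have "(\<Sum>K\<in>Pow J - {{}}. t K) = (\<Sum>K\<in>{K. K \<subset> J}. t (J - K))"
      by (rule sum.reindex_bij_witness[where i = "\<lambda>K. J - K" and j = "\<lambda>K. J - K"])
        (auto simp: double_diff)
    also have "\<dots> = - (\<Sum>K\<in>{K. K \<subset> J}. f K x)"
      unfolding sum_negf[symmetric] using True by (intro sum.cong) (auto simp: f_def t_def)
    finally show ?thesis by simp
  next
    case False
    then show ?thesis using bmf_dep_outside[OF g(1)] by (simp add: f_def)
  qed
  ultimately show ?thesis by (intro that[of f]) auto
qed

section \<open>Marginal expectations\<close>

text \<open>Independence makes the joint law of \<open>U\<close> and \<open>V\<close> the product of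
  their laws, so Fubini applies to the bounded \<open>F\<close>. In effect \<open>\<omega>'\<close>
  is an independent second outcome.\<close>

lemma (in prob_space) indep_var_integral_iterated:
  fixes F :: "'b \<times> 'b \<Rightarrow> real"
  assumes "indep_var A U B V" "F \<in> borel_measurable (A \<Otimes>\<^sub>M B)" "\<And>z. \<bar>F z\<bar> \<le> C"
  shows "(\<integral>\<omega>. F (U \<omega>, V \<omega>) \<partial>M) = (\<integral>\<omega>. (\<integral>\<omega>'. F (U \<omega>, V \<omega>') \<partial>M) \<partial>M)"
proof -
  note [measurable] = assms(2)
  have U [measurable]: "U \<in> measurable M A" and V [measurable]: "V \<in> measurable M B"
    and eq: "distr M A U \<Otimes>\<^sub>M distr M B V = distr M (A \<Otimes>\<^sub>M B) (\<lambda>x. (U x, V x))"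
    using assms(1) by (auto simp: indep_var_distribution_eq)
  interpret U: prob_space "distr M A U" by (rule prob_space_distr[OF U])
  interpret V: prob_space "distr M B V" by (rule prob_space_distr[OF V])
  interpret UV: pair_prob_space "distr M A U" "distr M B V" ..
  have int: "integrable (distr M A U \<Otimes>\<^sub>M distr M B V) F"
    using assms(3) by (intro UV.P.integrable_const_bound[where B = C]) auto
  have "(\<integral>\<omega>. F (U \<omega>, V \<omega>) \<partial>M) = integral\<^sup>L (distr M A U \<Otimes>\<^sub>M distr M B V) F"
    unfolding eq by (simp add: integral_distr)
  also have "\<dots> = (\<integral>u. (\<integral>v. F (u, v) \<partial>distr M B V) \<partial>distr M A U)"
    by (rule UV.integral_fst'[OF int, symmetric])
  also have "\<dots> = (\<integral>\<omega>. (\<integral>v. F (U \<omega>, v) \<partial>distr M B V) \<partial>M)"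
    by (intro integral_distr) measurable
  also have "\<dots> = (\<integral>\<omega>. (\<integral>\<omega>'. F (U \<omega>, V \<omega>') \<partial>M) \<partial>M)"
  proof (rule Bochner_Integration.integral_cong)
    fix \<omega> assume "\<omega> \<in> space M"
    then have "U \<omega> \<in> space A" by (rule measurable_space[OF U])
    then have [measurable]: "Pair (U \<omega>) \<in> measurable B (A \<Otimes>\<^sub>M B)" by simp
    have "(\<lambda>v. F (U \<omega>, v)) \<in> borel_measurable B" by measurable
    then show "(\<integral>v. F (U \<omega>, v) \<partial>distr M B V) = (\<integral>\<omega>'. F (U \<omega>, V \<omega>') \<partial>M)"
      by (intro integral_distr) auto
  qed simp
  finally show ?thesis .
qed

text \<open>Results on marginal expectations thereby cover the full expectation.\<close>

lemma expect_op_eq_marg: "expect_op M X D S = marg_expect_op M X D S {}"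
  by (simp add: fun_eq_iff expect_op_def marg_expect_op_def)

locale random_features = prob_space M for M :: "'a measure" +
  fixes D :: "nat set" and X :: "nat \<Rightarrow> 'a \<Rightarrow> real" and S :: "nat \<Rightarrow> real set"
  assumes finite_D: "finite D"
    and measurable_X [measurable]: "\<And>j. j \<in> D \<Longrightarrow> X j \<in> borel_measurable M"
    and borel_S: "\<And>j. j \<in> D \<Longrightarrow> S j \<in> sets borel"
    and S_nonempty: "\<And>j. j \<in> D \<Longrightarrow> S j \<noteq> {}"
    and X_in_S: "\<And>j. j \<in> D \<Longrightarrow> AE \<omega> in M. X j \<omega> \<in> S j"
begin

text \<open>Elements of \<open>bmf D S\<close> are only known to be measurable on the product of the \<open>S j\<close>, so it is
  convenient to modify \<open>X\<close> on a null set such that it takes all its values there.\<close>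

definition proj :: "nat \<Rightarrow> real \<Rightarrow> real" where
  "proj j t = (if t \<in> S j then t else (SOME s. s \<in> S j))"

definition Y :: "nat \<Rightarrow> 'a \<Rightarrow> real" where
  "Y j \<omega> = proj j (X j \<omega>)"

lemma proj_in: "j \<in> D \<Longrightarrow> proj j t \<in> S j"
  using S_nonempty by (auto simp: proj_def some_in_eq)

lemma measurable_proj: "j \<in> D \<Longrightarrow> proj j \<in> measurable borel (restrict_space borel (S j))"
  using proj_in borel_S by (intro measurable_restrict_space2) (auto simp: proj_def [abs_def])

lemma measurable_Y: "j \<in> D \<Longrightarrow> Y j \<in> measurable M (restrict_space borel (S j))"
  using measurable_comp[OF measurable_X measurable_proj] by (simp add: comp_def Y_def [abs_def])

lemma override_Y_PiE: "x \<in> PiE D S \<Longrightarrow> override_on (\<lambda>j\<in>D. Y j \<omega>) x J \<in> PiE D S"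
  using proj_in by (auto simp: override_on_def Y_def PiE_iff extensional_def)

text \<open>Joint measurability in point and outcome will make averages measurable in
  \<open>x\<close>. Each coordinate is read off from \<open>x\<close> or from
  \<open>Y j\<close>.\<close>

lemma measurable_override_Y:
  "(\<lambda>(x, \<omega>). override_on (\<lambda>j\<in>D. Y j \<omega>) x J) \<in>
     measurable (feature_space D S \<Otimes>\<^sub>M M) (feature_space D S)"
proof (rule measurable_feature_space)
  fix j assume j: "j \<in> D"
  note [measurable] = measurable_Y[OF j]
  show "(\<lambda>z. (case z of (x, \<omega>) \<Rightarrow> override_on (\<lambda>j\<in>D. Y j \<omega>) x J) j) \<in>
      measurable (feature_space D S \<Otimes>\<^sub>M M) (restrict_space borel (S j))"
    using j by (cases "j \<in> J") (simp_all add: override_on_def case_prod_beta)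
next
  fix z assume "z \<in> space (feature_space D S \<Otimes>\<^sub>M M)"
  then show "(case z of (x, \<omega>) \<Rightarrow> override_on (\<lambda>j\<in>D. Y j \<omega>) x J) \<in> PiE D S"
    by (cases z) (simp add: space_pair_measure space_feature_space override_Y_PiE)
qed

lemma borel_measurable_override_Y:
  assumes "g \<in> bmf D S"
  shows "(\<lambda>(x, \<omega>). g (override_on (\<lambda>j\<in>D. Y j \<omega>) x J)) \<in>
     borel_measurable (feature_space D S \<Otimes>\<^sub>M M)"
proof -
  have "g \<in> borel_measurable (feature_space D S)" using assms by (auto simp: bmf_def)
  from measurable_comp[OF measurable_override_Y this] show ?thesis
    by (simp add: comp_def case_prod_beta)
qed

lemma borel_measurable_override_Y':
  assumes "g \<in> bmf D S" "x \<in> PiE D S"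
  shows "(\<lambda>\<omega>. g (override_on (\<lambda>j\<in>D. Y j \<omega>) x J)) \<in> borel_measurable M"
proof -
  have "Pair x \<in> measurable M (feature_space D S \<Otimes>\<^sub>M M)"
    using assms(2) by (intro measurable_Pair1') (simp add: space_feature_space)
  from measurable_comp[OF this borel_measurable_override_Y[OF assms(1)]] show ?thesis
    by (simp add: comp_def)
qed

lemma integrable_override_Y:
  assumes "g \<in> bmf D S" "x \<in> PiE D S"
  shows "integrable M (\<lambda>\<omega>. g (override_on (\<lambda>j\<in>D. Y j \<omega>) x J))"
proof -
  obtain B where "\<And>x. \<bar>g x\<bar> \<le> B" using bmfE[OF assms(1)] by metis
  then show ?thesis
    using borel_measurable_override_Y'[OF assms] by (intro integrable_const_bound[where B = B]) auto
qed

text \<open>A union of finitely many null sets is null, so all coordinates agree at once.\<close>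

lemma AE_X_eq_Y: "AE \<omega> in M. (\<lambda>j\<in>D. X j \<omega>) = (\<lambda>j\<in>D. Y j \<omega>)"
proof -
  have "AE \<omega> in M. \<forall>j\<in>D. X j \<omega> \<in> S j"
    using finite_D X_in_S by (intro AE_finite_allI) auto
  then show ?thesis
    by eventually_elim (auto simp: Y_def proj_def)
qed

text \<open>Changing \<open>X\<close> on a null set preserves the integral once both integrands are
  measurable. For the one with \<open>X\<close> this needs an argument, since \<open>X\<close> may
  leave the product on which \<open>g\<close> is known to be measurable.\<close>

lemma marg_expect_op_eq_Y:
  assumes "g \<in> bmf D S"
  shows "marg_expect_op M X D S J g =
    (\<lambda>x. if x \<in> PiE D S then (\<integral>\<omega>. g (override_on (\<lambda>j\<in>D. Y j \<omega>) x J) \<partial>M) else 0)"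
proof
  fix x
  show "marg_expect_op M X D S J g x =
    (if x \<in> PiE D S then (\<integral>\<omega>. g (override_on (\<lambda>j\<in>D. Y j \<omega>) x J) \<partial>M) else 0)"
  proof (cases "x \<in> PiE D S")
    case True
    \<comment> \<open>Only coordinates outside \<open>J\<close> are tested, because \<open>x\<close>
      overwrites the others. Off \<open>A\<close> the overridden point leaves the product, where
      \<open>g\<close> is 0 by convention, so the integrand is the version with \<open>Y\<close> cut
      off by \<open>A\<close>.\<close>
    define A where "A = {\<omega> \<in> space M. \<forall>j\<in>D - J. X j \<omega> \<in> S j}"
    have [measurable]: "A \<in> sets M"
      unfolding A_def using borel_S finite_D by measurable
    have "g (override_on (\<lambda>j\<in>D. X j \<omega>) x J) =
        indicator A \<omega> * g (override_on (\<lambda>j\<in>D. Y j \<omega>) x J)" if \<omega>: "\<omega> \<in> space M" for \<omega>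
    proof (cases "\<omega> \<in> A")
      case True
      then have "override_on (\<lambda>j\<in>D. X j \<omega>) x J = override_on (\<lambda>j\<in>D. Y j \<omega>) x J"
        by (auto simp: A_def override_on_def Y_def proj_def fun_eq_iff)
      with True show ?thesis by simp
    next
      case False
      then obtain j where "j \<in> D - J" "X j \<omega> \<notin> S j" using \<omega> by (auto simp: A_def)
      then have "override_on (\<lambda>j\<in>D. X j \<omega>) x J j \<notin> S j" "j \<in> D"
        by (auto simp: override_on_def)
      then have "override_on (\<lambda>j\<in>D. X j \<omega>) x J \<notin> PiE D S" by blast
      with False assms show ?thesis by (auto simp: bmf_def)
    qed
    then have "(\<lambda>\<omega>. g (override_on (\<lambda>j\<in>D. X j \<omega>) x J)) \<in> borel_measurable M"
      using borel_measurable_override_Y'[OF assms True]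
      by (subst measurable_cong[where g = "\<lambda>\<omega>. indicator A \<omega> * g (override_on (\<lambda>j\<in>D. Y j \<omega>) x J)"])
        auto
    moreover have "AE \<omega> in M. g (override_on (\<lambda>j\<in>D. X j \<omega>) x J) =
        g (override_on (\<lambda>j\<in>D. Y j \<omega>) x J)"
      using AE_X_eq_Y by eventually_elim simp
    ultimately have "(\<integral>\<omega>. g (override_on (\<lambda>j\<in>D. X j \<omega>) x J) \<partial>M) =
        (\<integral>\<omega>. g (override_on (\<lambda>j\<in>D. Y j \<omega>) x J) \<partial>M)"
      by (intro integral_cong_AE borel_measurable_override_Y'[OF assms True])
    then show ?thesis using True by (simp add: marg_expect_op_def)
  qed (simp add: marg_expect_op_def)
qed

lemma linear_marg_expect_op:
  "linear_operator (bmf D S) (bmf_dep D S J) (marg_expect_op M X D S J)"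
  unfolding linear_operator_def
proof (intro conjI ballI allI)
  fix g assume g: "g \<in> bmf D S"
  obtain B where B: "\<And>x. \<bar>g x\<bar> \<le> B" using bmfE[OF g] by metis
  have "marg_expect_op M X D S J g \<in> bmf D S"
  proof (rule bmfI)
    \<comment> \<open>An integral of a jointly measurable function is measurable in the
      parameter.\<close>
    have "(\<lambda>x. \<integral>\<omega>. g (override_on (\<lambda>j\<in>D. Y j \<omega>) x J) \<partial>M) \<in> borel_measurable (feature_space D S)"
      by (rule borel_measurable_lebesgue_integral[OF borel_measurable_override_Y[OF g]])
    then show "marg_expect_op M X D S J g \<in> borel_measurable (feature_space D S)"
      unfolding marg_expect_op_eq_Y[OF g]
      by (subst measurable_cong[where g = "\<lambda>x. \<integral>\<omega>. g (override_on (\<lambda>j\<in>D. Y j \<omega>) x J) \<partial>M"])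
        (auto simp: space_feature_space)
    fix x assume x: "x \<in> PiE D S"
    have "\<bar>\<integral>\<omega>. g (override_on (\<lambda>j\<in>D. Y j \<omega>) x J) \<partial>M\<bar> \<le>
        (\<integral>\<omega>. \<bar>g (override_on (\<lambda>j\<in>D. Y j \<omega>) x J)\<bar> \<partial>M)"
      by (rule integral_abs_bound)
    also have "\<dots> \<le> (\<integral>\<omega>. B \<partial>M)"
      using integrable_override_Y[OF g x] B by (intro integral_mono) auto
    finally show "\<bar>marg_expect_op M X D S J g x\<bar> \<le> B"
      using x by (simp add: marg_expect_op_eq_Y[OF g] prob_space)
  qed (simp add: marg_expect_op_def)
  moreover have "marg_expect_op M X D S J g x = marg_expect_op M X D S J g y"
    if "x \<in> PiE D S" "y \<in> PiE D S" "\<forall>j\<in>J. x j = y j" for x y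
  proof -
    have "override_on f x J = override_on f y J" for f
      using that(3) by (auto simp: override_on_def)
    with that(1,2) show ?thesis by (simp add: marg_expect_op_def)
  qed
  ultimately show "marg_expect_op M X D S J g \<in> bmf_dep D S J"
    by (intro bmf_depI) blast+
  show "marg_expect_op M X D S J (\<lambda>x. c * g x) = (\<lambda>x. c * marg_expect_op M X D S J g x)" for c
    by (simp add: marg_expect_op_def fun_eq_iff)
  fix h assume h: "h \<in> bmf D S"
  have "(\<lambda>x. g x + h x) \<in> bmf D S"
    using bmf_dep_add[of g D S D h] g h by (simp add: bmf_dep_all)
  \<comment> \<open>Additivity of the integral needs integrable summands, which the form with
    \<open>Y\<close> supplies.\<close>
  from marg_expect_op_eq_Y[OF this]
  show "marg_expect_op M X D S J (\<lambda>x. g x + h x) =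
      (\<lambda>x. marg_expect_op M X D S J g x + marg_expect_op M X D S J h x)"
    by (simp add: marg_expect_op_eq_Y[OF g] marg_expect_op_eq_Y[OF h]
        integrable_override_Y[OF g] integrable_override_Y[OF h] fun_eq_iff)
qed

lemma linear_expect_op: "linear_operator (bmf D S) (bmf_dep D S {}) (expect_op M X D S)"
  unfolding expect_op_eq_marg by (rule linear_marg_expect_op)

text \<open>The averaged coordinates are invisible to \<open>g\<close>, and a constant integrates to
  itself under a probability measure.\<close>

lemma marg_expect_op_id:
  assumes "g \<in> bmf_dep D S J"
  shows "marg_expect_op M X D S J g = g"
proof -
  have g: "g \<in> bmf D S" by (rule bmf_dep_in_bmf[OF assms])
  have "g (override_on (\<lambda>j\<in>D. Y j \<omega>) x J) = g x" if "x \<in> PiE D S" for \<omega> x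
    using that by (intro bmf_dep_cong[OF assms] override_Y_PiE) (auto simp: override_on_def)
  then show ?thesis
    using bmf_dep_outside[OF assms] by (auto simp: marg_expect_op_eq_Y[OF g] prob_space)
qed

lemma expect_op_id: "g \<in> bmf_dep D S {} \<Longrightarrow> expect_op M X D S g = g"
  unfolding expect_op_eq_marg by (rule marg_expect_op_id)

text \<open>The left side averages over two separate outcomes, one for \<open>J - K\<close> and one
  for \<open>D - J\<close>. By independence of these blocks, a single outcome gives the same
  value.\<close>

lemma marg_expect_op_tower:
  assumes ind: "indep_vars (\<lambda>_. borel) X D" and "K \<subseteq> J" "J \<subseteq> D" and g: "g \<in> bmf D S"
  shows "marg_expect_op M X D S K (marg_expect_op M X D S J g) = marg_expect_op M X D S K g"
proof
  fix x
  have g': "marg_expect_op M X D S J g \<in> bmf D S"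
    by (rule bmf_dep_in_bmf[OF linear_operatorD(1)[OF linear_marg_expect_op g]])
  show "marg_expect_op M X D S K (marg_expect_op M X D S J g) x = marg_expect_op M X D S K g x"
  proof (cases "x \<in> PiE D S")
    case True
    \<comment> \<open>Independence survives the modification, as each \<open>Y j\<close> is a
      measurable function of \<open>X j\<close>.\<close>
    have "indep_vars (\<lambda>j. restrict_space borel (S j)) (\<lambda>j \<omega>. proj j (X j \<omega>)) D"
      by (rule indep_vars_compose2[OF ind measurable_proj])
    then have "indep_vars (\<lambda>j. restrict_space borel (S j)) Y D"
      by (simp add: Y_def [abs_def])
    then have indep: "indep_var (feature_space J S) (\<lambda>\<omega>. \<lambda>j\<in>J. Y j \<omega>)
        (feature_space (D - J) S) (\<lambda>\<omega>. \<lambda>j\<in>D - J. Y j \<omega>)"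
      using assms by (intro indep_var_restrict) auto
    \<comment> \<open>Glues \<open>x\<close> on \<open>K\<close>, the first sample on
      \<open>J - K\<close> and the second on \<open>D - J\<close>; \<open>undefined\<close>
      elsewhere makes the result extensional.\<close>
    define m where "m = (\<lambda>(u, v) j. if j \<in> K then x j else if j \<in> J then u j
      else if j \<in> D then v j else undefined :: real)"
    have mP: "m \<in> measurable (feature_space J S \<Otimes>\<^sub>M feature_space (D - J) S) (feature_space D S)"
    proof (rule measurable_feature_space)
      fix j assume j: "j \<in> D"
      have "x j \<in> space (restrict_space borel (S j))"
        using True j by (auto simp: space_restrict_space)
      then show "(\<lambda>z. m z j) \<in> measurable (feature_space J S \<Otimes>\<^sub>M feature_space (D - J) S)
          (restrict_space borel (S j))"
        using j by (cases "j \<in> K"; cases "j \<in> J") (simp_all add: m_def case_prod_beta)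
    next
      fix z assume "z \<in> space (feature_space J S \<Otimes>\<^sub>M feature_space (D - J) S)"
      then show "m z \<in> PiE D S"
        using True assms(2,3)
        by (auto simp: m_def space_pair_measure space_feature_space PiE_iff extensional_def)
    qed
    have gP: "g \<in> borel_measurable (feature_space D S)" using g by (simp add: bmf_def)
    obtain B where B: "\<And>x. \<bar>g x\<bar> \<le> B" using bmfE[OF g] by metis
    have eq: "m (\<lambda>j\<in>J. Y j \<omega>, \<lambda>j\<in>D - J. Y j \<omega>') =
        override_on (\<lambda>j\<in>D. Y j \<omega>') (override_on (\<lambda>j\<in>D. Y j \<omega>) x K) J" for \<omega> \<omega>'
      using assms(2,3) by (auto simp: m_def override_on_def fun_eq_iff)
    \<comment> \<open>With a single outcome the nested override collapses, so \<open>eq\<close> with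
      \<open>\<omega>' = \<omega>\<close> describes the right side of the tower rule.\<close>
    have eq': "override_on (\<lambda>j\<in>D. Y j \<omega>) (override_on (\<lambda>j\<in>D. Y j \<omega>) x K) J =
        override_on (\<lambda>j\<in>D. Y j \<omega>) x K" for \<omega>
      using assms(2) by (auto simp: override_on_def fun_eq_iff)
    have "(\<lambda>z. g (m z)) \<in> borel_measurable (feature_space J S \<Otimes>\<^sub>M feature_space (D - J) S)"
      using measurable_comp[OF mP gP] by (simp add: comp_def)
    from indep_var_integral_iterated[OF indep this, of B] B
    have "(\<integral>\<omega>. g (override_on (\<lambda>j\<in>D. Y j \<omega>) x K) \<partial>M) =
      (\<integral>\<omega>. (\<integral>\<omega>'. g (override_on (\<lambda>j\<in>D. Y j \<omega>') (override_on (\<lambda>j\<in>D. Y j \<omega>) x K) J) \<partial>M) \<partial>M)"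
      by (simp add: eq eq')
    with True show ?thesis
      unfolding marg_expect_op_eq_Y[OF g'] by (simp add: marg_expect_op_eq_Y[OF g] override_Y_PiE)
  qed (simp add: marg_expect_op_def)
qed

end

section \<open>The recursively defined operators\<close>

locale functional_decomposition = random_features M D X S
  for M :: "'a measure" and D X S +
  fixes L :: "nat set \<Rightarrow> rfun \<Rightarrow> rfun"
  assumes linear_L: "\<And>J. J \<subseteq> D \<Longrightarrow> J \<noteq> {} \<Longrightarrow> linear_operator (bmf D S) (bmf_dep D S J) (L J)"
begin

abbreviation H :: "nat set \<Rightarrow> rfun \<Rightarrow> rfun" where
  "H \<equiv> H_op M X D S L"

lemma H_empty: "H {} = expect_op M X D S"
  by (simp add: fun_eq_iff H_op.simps)

lemma H_nonempty:
  assumes "J \<subseteq> D" "J \<noteq> {}"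
  shows "H J g = (\<lambda>x. L J g x - (\<Sum>K\<in>{K. K \<subset> J}. H K (L J g) x))"
  using assms finite_subset[OF assms(1) finite_D] by (subst H_op.simps) simp

lemma sum_Pow_H:
  assumes "J \<subseteq> D"
  shows "(\<Sum>K\<in>Pow J. H K g x) = H J g x + (\<Sum>K\<in>{K. K \<subset> J}. H K g x)"
proof -
  have "finite J" using assms finite_D finite_subset by blast
  then have "finite {K. K \<subset> J}" by (auto intro: finite_subset[of _ "Pow J"])
  moreover have "Pow J = insert J {K. K \<subset> J}" by auto
  ultimately show ?thesis by (simp only: sum.insert) simp
qed

lemma L_in: "J \<subseteq> D \<Longrightarrow> J \<noteq> {} \<Longrightarrow> g \<in> bmf D S \<Longrightarrow> L J g \<in> bmf_dep D S J"
  using linear_operatorD(1)[OF linear_L] .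

lemma subset_induct [consumes 1, case_names psubset]:
  assumes "J \<subseteq> D" "\<And>J. J \<subseteq> D \<Longrightarrow> (\<And>K. K \<subset> J \<Longrightarrow> Q K) \<Longrightarrow> Q J"
  shows "Q J"
proof -
  have "finite J" using assms(1) finite_D finite_subset by blast
  then show ?thesis using assms(1)
  proof (induction J rule: finite_psubset_induct)
    case (psubset J)
    show ?case
    proof (rule assms(2)[OF psubset.prems])
      fix K assume "K \<subset> J"
      then show "Q K" using psubset.prems by (intro psubset.IH) auto
    qed
  qed
qed

text \<open>The recursion feeds \<open>L J g\<close> into operators of proper subsets, linear by
  induction, whose values in V_K lie in V_J as well.\<close>

lemma linear_H: "J \<subseteq> D \<Longrightarrow> linear_operator (bmf D S) (bmf_dep D S J) (H J)"
proof (induction J rule: subset_induct)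
  case (psubset J)
  show ?case
  proof (cases "J = {}")
    case True
    then show ?thesis by (simp add: H_empty linear_expect_op)
  next
    case False
    note L = linear_L[OF psubset(1) False]
    have L': "\<And>g. g \<in> bmf D S \<Longrightarrow> L J g \<in> bmf D S"
      by (rule bmf_dep_in_bmf[OF L_in[OF psubset(1) False]])
    show ?thesis
      unfolding linear_operator_def
    proof (intro conjI ballI allI)
      fix g assume g: "g \<in> bmf D S"
      have "H K (L J g) \<in> bmf_dep D S J" if "K \<subset> J" for K
        using linear_operatorD(1)[OF psubset(2)[OF that] L'[OF g]] bmf_dep_mono[of K J] that by blast
      then show "H J g \<in> bmf_dep D S J"
        unfolding H_nonempty[OF psubset(1) False]
        using g by (intro bmf_dep_diff bmf_dep_sum L_in[OF psubset(1) False]) auto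
      show "H J (\<lambda>x. c * g x) = (\<lambda>x. c * H J g x)" for c
      proof -
        have "(\<Sum>K\<in>{K. K \<subset> J}. H K (\<lambda>x. c * L J g x) x) =
            (\<Sum>K\<in>{K. K \<subset> J}. c * H K (L J g) x)" for x
          using linear_operatorD(3)[OF psubset(2) L'[OF g]] by (intro sum.cong) auto
        then show ?thesis
          unfolding H_nonempty[OF psubset(1) False] linear_operatorD(3)[OF L g]
          by (simp add: right_diff_distrib sum_distrib_left)
      qed
      fix h assume h: "h \<in> bmf D S"
      have "(\<Sum>K\<in>{K. K \<subset> J}. H K (\<lambda>x. L J g x + L J h x) x) =
          (\<Sum>K\<in>{K. K \<subset> J}. H K (L J g) x + H K (L J h) x)" for x
        using linear_operatorD(2)[OF psubset(2) L'[OF g] L'[OF h]] by (intro sum.cong) auto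
      then show "H J (\<lambda>x. g x + h x) = (\<lambda>x. H J g x + H J h x)"
        unfolding H_nonempty[OF psubset(1) False] linear_operatorD(2)[OF L g h]
        by (simp add: sum.distrib algebra_simps)
    qed
  qed
qed

lemma H_in: "J \<subseteq> D \<Longrightarrow> g \<in> bmf D S \<Longrightarrow> H J g \<in> bmf_dep D S J"
  using linear_operatorD(1)[OF linear_H] .

lemma H_in_bmf: "J \<subseteq> D \<Longrightarrow> g \<in> bmf D S \<Longrightarrow> H J g \<in> bmf D S"
  by (rule bmf_dep_in_bmf[OF H_in])

lemma L_in_bmf: "J \<subseteq> D \<Longrightarrow> J \<noteq> {} \<Longrightarrow> g \<in> bmf D S \<Longrightarrow> L J g \<in> bmf D S"
  by (rule bmf_dep_in_bmf[OF L_in])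

text \<open>Pushes a linear operator through the recursion; it is used with the expectation and with
  another \<open>H N\<close> in the role of \<open>T\<close>.\<close>

lemma linear_H_apply:
  assumes "linear_operator (bmf D S) W T" "J \<subseteq> D" "J \<noteq> {}" "g \<in> bmf D S"
  shows "T (H J g) = (\<lambda>x. T (L J g) x - (\<Sum>K\<in>{K. K \<subset> J}. T (H K (L J g)) x))"
proof -
  have L: "L J g \<in> bmf D S" using L_in_bmf assms by blast
  have HK: "H K (L J g) \<in> bmf D S" if "K \<in> {K. K \<subset> J}" for K
    using that assms L by (intro H_in_bmf) auto
  show ?thesis
    unfolding H_nonempty[OF assms(2,3)]
    using linear_operator_diff[OF assms(1) L bmf_sum[of "{K. K \<subset> J}", OF HK]]
      linear_operator_sum[of D S W T "{K. K \<subset> J}", OF assms(1) HK] by simp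
qed

text \<open>Nonemptiness is part of the induction claim because the proper subsets include the empty
  set, which behaves differently.\<close>

lemma expect_H:
  "J \<subseteq> D \<Longrightarrow> J \<noteq> {} \<longrightarrow> (\<forall>g\<in>bmf D S. expect_op M X D S (H J g) = (\<lambda>_. 0))"
proof (induction J rule: subset_induct)
  case (psubset J)
  show ?case
  proof (intro impI ballI)
    fix g assume J: "J \<noteq> {}" and g: "g \<in> bmf D S"
    let ?E = "expect_op M X D S"
    have Lg: "L J g \<in> bmf D S" using L_in_bmf psubset(1) J g by blast
    have fin: "finite {K. K \<subset> J}"
      using finite_subset[OF psubset(1) finite_D] by (auto intro: finite_subset[of _ "Pow J"])
    have "(\<Sum>K\<in>{K. K \<subset> J}. ?E (H K (L J g)) x) = ?E (L J g) x" for x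
    proof -
      \<comment> \<open>By induction only \<open>K = {}\<close> contributes, and there the
        expectation of a constant is that constant. The result cancels the leading term of the
        recursion.\<close>
      have "(\<Sum>K\<in>{K. K \<subset> J}. ?E (H K (L J g)) x) =
          (\<Sum>K\<in>{K. K \<subset> J}. if K = {} then ?E (L J g) x else 0)"
        using psubset(2) Lg linear_operatorD(1)[OF linear_expect_op Lg]
        by (intro sum.cong) (auto simp: H_empty expect_op_id)
      also have "\<dots> = ?E (L J g) x"
        using fin J by (subst sum.delta) auto
      finally show ?thesis .
    qed
    then show "?E (H J g) = (\<lambda>_. 0)"
      using linear_H_apply[OF linear_expect_op psubset(1) J g] by simp
  qed
qed

section \<open>(P2) and (P3) at a single index set, and their derivation from the starred
  properties\<close>

text \<open>\<open>annihilates\<close> and \<open>reproduces\<close> localise (P2) and (P3) to one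
  index set, so that an induction can assume them for proper subsets only.\<close>

definition annihilates :: "nat set \<Rightarrow> bool" where
  "annihilates J \<longleftrightarrow> (\<forall>g\<in>bmf D S. deriv_zero D S J g \<longrightarrow> H J g = (\<lambda>_. 0))"

definition reproduces :: "nat set \<Rightarrow> bool" where
  "reproduces J \<longleftrightarrow> (\<forall>g\<in>bmf_dep D S J. (\<lambda>x. \<Sum>K\<in>Pow J. H K g x) = g)"

lemma P2_iff: "P2 D S H \<longleftrightarrow> (\<forall>J\<subseteq>D. annihilates J)"
  by (simp add: P2_def annihilates_def)

lemma P3_iff: "P3 D S H \<longleftrightarrow> (\<forall>J\<subseteq>D. reproduces J)"
  by (simp add: P3_def reproduces_def)

lemma H_unrelated:
  assumes "annihilates J" "J \<subseteq> D" "\<not> J \<subseteq> K" "g \<in> bmf_dep D S K"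
  shows "H J g = (\<lambda>_. 0)"
  using assms(1) deriv_zero_bmf_dep[OF finite_D assms(2-4)] bmf_dep_in_bmf[OF assms(4)]
  by (auto simp: annihilates_def)

text \<open>Split \<open>h\<close> into functions \<open>f N\<close> with
  \<open>N \<subset> J\<close>. On \<open>f N\<close> the operators \<open>H K\<close> with
  \<open>K\<close> not inside \<open>N\<close> vanish, and those with \<open>K \<subseteq> N\<close>
  add up to the identity. Hence the factor in front of \<open>L J\<close> in the recursion kills
  \<open>h\<close>.\<close>

lemma sum_lower_H:
  assumes "J \<subseteq> D" and below: "\<And>K. K \<subset> J \<Longrightarrow> annihilates K" "\<And>K. K \<subset> J \<Longrightarrow> reproduces K"
    and h: "h \<in> bmf_dep D S J" "deriv_zero D S J h"
  shows "(\<Sum>K\<in>{K. K \<subset> J}. H K h x) = h x"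
proof -
  obtain f where f: "\<And>K. K \<subset> J \<Longrightarrow> f K \<in> bmf_dep D S K"
    and hf: "h = (\<lambda>x. \<Sum>K\<in>{K. K \<subset> J}. f K x)"
    using deriv_zero_decompose[OF finite_D assms(1) S_nonempty h] by blast
  have fV: "\<And>K. K \<in> {K. K \<subset> J} \<Longrightarrow> f K \<in> bmf D S" using f by (auto intro: bmf_dep_in_bmf)
  have fin: "finite {K. K \<subset> J}"
    using finite_subset[OF assms(1) finite_D] by (auto intro: finite_subset[of _ "Pow J"])
  have lower: "(\<Sum>K\<in>{K. K \<subset> J}. H K (f N) x) = f N x" if N: "N \<subset> J" for N
  proof -
    have "(\<Sum>K\<in>{K. K \<subset> J}. H K (f N) x) = (\<Sum>K\<in>Pow N. H K (f N) x)"
    proof (rule sum.mono_neutral_right[OF fin])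
      show "\<forall>K\<in>{K. K \<subset> J} - Pow N. H K (f N) x = 0"
      proof
        fix K assume K: "K \<in> {K. K \<subset> J} - Pow N"
        then have "K \<subset> J" "K \<subseteq> D" "\<not> K \<subseteq> N" using assms(1) by auto
        then show "H K (f N) x = 0"
          using H_unrelated[OF below(1) _ _ f[OF N]] by simp
      qed
    qed (use N in auto)
    also have "\<dots> = f N x"
      using below(2)[OF N] f[OF N] by (auto simp: reproduces_def fun_eq_iff)
    finally show ?thesis .
  qed
  have "(\<Sum>K\<in>{K. K \<subset> J}. H K h x) = (\<Sum>K\<in>{K. K \<subset> J}. \<Sum>N\<in>{K. K \<subset> J}. H K (f N) x)"
    unfolding hf using assms(1)
    by (intro sum.cong fun_cong[OF linear_operator_sum[OF linear_H fV]]) auto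
  also have "\<dots> = (\<Sum>N\<in>{K. K \<subset> J}. \<Sum>K\<in>{K. K \<subset> J}. H K (f N) x)"
    by (rule sum.swap)
  also have "\<dots> = (\<Sum>N\<in>{K. K \<subset> J}. f N x)"
    using lower by (intro sum.cong) auto
  finally show ?thesis by (simp add: hf)
qed

lemma star_imp_P2_P3:
  assumes P2s: "P2_star D S L" and P3s: "P3_star D S L" and "J \<subseteq> D"
  shows "annihilates J \<and> reproduces J"
  using assms(3)
proof (induction J rule: subset_induct)
  case (psubset J)
  show ?case
  proof (cases "J = {}")
    case True
    \<comment> \<open>For the empty index set the difference operator is the identity.\<close>
    have "g = (\<lambda>_. 0)" if "g \<in> bmf D S" "deriv_zero D S {} g" for g
      using that by (auto simp: deriv_zero_def delta_def subst_vars_def bmf_def fun_eq_iff)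
    then show ?thesis
      using True linear_operator_zero[OF linear_expect_op] expect_op_id
      by (auto simp: annihilates_def reproduces_def H_empty)
  next
    case False
    note below = conjunct1[OF psubset(2)] conjunct2[OF psubset(2)]
    have "annihilates J"
      unfolding annihilates_def
    proof (intro ballI impI)
      fix g assume g: "g \<in> bmf D S" "deriv_zero D S J g"
      then have "deriv_zero D S J (L J g)"
        using P2s psubset(1) False by (auto simp: P2_star_def)
      \<comment> \<open>\<open>L J g\<close> lies in V_J with vanishing difference, so the lower sum
        in the recursion equals \<open>L J g\<close> itself.\<close>
      then show "H J g = (\<lambda>_. 0)"
        unfolding H_nonempty[OF psubset(1) False]
        by (simp add: sum_lower_H[OF psubset(1) below L_in[OF psubset(1) False g(1)]])
    qed
    moreover have "reproduces J"
      unfolding reproduces_def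
    proof (intro ballI ext)
      fix g x assume g: "g \<in> bmf_dep D S J"
      then have gV: "g \<in> bmf D S" by (rule bmf_dep_in_bmf)
      have Lg: "L J g \<in> bmf_dep D S J" by (rule L_in[OF psubset(1) False gV])
      have LgV: "L J g \<in> bmf D S" by (rule bmf_dep_in_bmf[OF Lg])
      have dz: "deriv_zero D S J (\<lambda>x. L J g x - g x)"
        using P3s psubset(1) False g by (auto simp: P3_star_def)
      \<comment> \<open>\<open>sum_lower_H\<close> is applied to the error \<open>L J g - g\<close>.
        After splitting by linearity, the sum over \<open>H K (L J g)\<close> is the one in the
        recursion for \<open>H J g\<close>, which leaves \<open>g\<close> minus the lower terms of
        \<open>g\<close>.\<close>
      have "L J g x - g x = (\<Sum>K\<in>{K. K \<subset> J}. H K (\<lambda>x. L J g x - g x) x)"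
        by (rule sum_lower_H[OF psubset(1) below bmf_dep_diff[OF Lg g] dz, symmetric])
      also have "\<dots> = (\<Sum>K\<in>{K. K \<subset> J}. H K (L J g) x - H K g x)"
        using psubset(1)
        by (intro sum.cong fun_cong[OF linear_operator_diff[OF linear_H LgV gV]]) auto
      finally show "(\<Sum>K\<in>Pow J. H K g x) = g x"
        unfolding sum_Pow_H[OF psubset(1)] H_nonempty[OF psubset(1) False, of g]
        by (simp add: sum_subtractf)
    qed
    ultimately show ?thesis by blast
  qed
qed

section \<open>From properties of \<open>H\<close> back to properties of \<open>L\<close>\<close>

lemma H_lower_diff:
  assumes "J \<subseteq> D" "g \<in> bmf D S" "h \<in> bmf D S"
  shows "deriv_zero D S J (\<lambda>x. \<Sum>K\<in>{K. K \<subset> J}. H K g x - H K h x)"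
  using assms by (intro deriv_zero_sum_lower finite_D bmf_dep_diff H_in) auto

text \<open>If \<open>H J g\<close> is zero, the recursion presents \<open>L J g\<close> as a sum of
  functions of fewer variables.\<close>

lemma P2_imp_star:
  assumes "P2 D S H" shows "P2_star D S L"
  unfolding P2_star_def
proof (intro allI impI ballI)
  fix J g assume J: "J \<subseteq> D" "J \<noteq> {}" and g: "g \<in> bmf D S" "deriv_zero D S J g"
  have "H J g = (\<lambda>_. 0)" using assms J g by (auto simp: P2_def)
  then have "L J g = (\<lambda>x. \<Sum>K\<in>{K. K \<subset> J}. H K (L J g) x)"
    unfolding H_nonempty[OF J] by (simp add: fun_eq_iff)
  moreover have "deriv_zero D S J (\<lambda>x. \<Sum>K\<in>{K. K \<subset> J}. H K (L J g) x)"
    using J g by (intro deriv_zero_sum_lower finite_D H_in L_in_bmf) auto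
  ultimately show "deriv_zero D S J (L J g)" by simp
qed

text \<open>Comparing the recursion with the sum for \<open>h\<close>, the term \<open>H J g\<close>
  drops out and only functions of proper subsets of variables remain. Taking \<open>h\<close> as
  \<open>g\<close> serves (P3), taking it as the marginal expectation serves (P6).\<close>

lemma deriv_zero_L_diff:
  assumes J: "J \<subseteq> D" "J \<noteq> {}" and g: "g \<in> bmf D S"
    and sum: "(\<lambda>x. \<Sum>K\<in>Pow J. H K g x) = h"
  shows "deriv_zero D S J (\<lambda>x. L J g x - h x)"
proof -
  have "L J g x - h x = (\<Sum>K\<in>{K. K \<subset> J}. H K (L J g) x - H K g x)" for x
    using sum_Pow_H[OF J(1), of g x] fun_cong[OF H_nonempty[OF J, of g], of x]
    unfolding sum[symmetric] by (simp add: sum_subtractf)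
  then show ?thesis using H_lower_diff[OF J(1) L_in_bmf[OF J g] g] by simp
qed

lemma P3_imp_star: "P3 D S H \<Longrightarrow> P3_star D S L"
  unfolding P3_star_def P3_def
  by (intro allI impI ballI deriv_zero_L_diff) (auto intro: bmf_dep_in_bmf)

lemma P6_imp_star: "P6 M X D S H \<Longrightarrow> P6_star M X D S L"
  unfolding P6_star_def P6_def
  by (intro allI impI ballI deriv_zero_L_diff) auto

section \<open>Idempotence and mutual annihilation\<close>

text \<open>(P4) and (P5) are proved together by induction on the inner index \<open>J\<close>,
  since the case \<open>N = J\<close> relies on the vanishing for
  \<open>N \<subset> J\<close>.\<close>

lemma H_comp_H:
  assumes P2: "P2 D S H" and P3: "P3 D S H" and "J \<subseteq> D"
  shows "\<forall>N\<subseteq>D. \<forall>g\<in>bmf D S. H N (H J g) = (if N = J then H J g else (\<lambda>_. 0))"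
  using assms(3)
proof (induction J rule: subset_induct)
  case (psubset J)
  have fin: "finite {K. K \<subset> J}"
    using finite_subset[OF psubset(1) finite_D] by (auto intro: finite_subset[of _ "Pow J"])
  \<comment> \<open>After applying \<open>H N\<close> to the recursion, the induction hypothesis
    keeps only the term \<open>K = N\<close>, which equals \<open>H N (L J g)\<close> and cancels
    the leading term.\<close>
  have below: "H N (H J g) = (\<lambda>_. 0)" if "N \<subset> J" "g \<in> bmf D S" for N g
  proof -
    have N: "N \<subseteq> D" "J \<noteq> {}" using that psubset(1) by auto
    have Lg: "L J g \<in> bmf D S" using L_in_bmf[OF psubset(1) N(2) that(2)] .
    have "(\<Sum>K\<in>{K. K \<subset> J}. H N (H K (L J g)) x) =
        (\<Sum>K\<in>{K. K \<subset> J}. if K = N then H N (L J g) x else 0)" for x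
      using psubset(2) N(1) Lg by (intro sum.cong) auto
    also have "\<dots> x = H N (L J g) x" for x
      using fin that by (subst sum.delta) auto
    finally show ?thesis
      unfolding linear_H_apply[OF linear_H[OF N(1)] psubset(1) N(2) that(2)] by simp
  qed
  show ?case
  proof (intro allI impI ballI)
    fix N g assume N: "N \<subseteq> D" and g: "g \<in> bmf D S"
    consider "\<not> N \<subseteq> J" | "N \<subset> J" | "N = J" by blast
    then show "H N (H J g) = (if N = J then H J g else (\<lambda>_. 0))"
    proof cases
      case 1
      then show ?thesis
        using H_unrelated[OF _ N 1 H_in[OF psubset(1) g]] P2 N by (auto simp: P2_iff)
    next
      case 2
      then show ?thesis using below[OF 2 g] by auto
    next
      case 3
      \<comment> \<open>(P3) reproduces \<open>H J g\<close>, and by \<open>below\<close> only the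
        top summand \<open>K = J\<close> is nonzero.\<close>
      have "(\<lambda>x. \<Sum>K\<in>Pow J. H K (H J g) x) = H J g"
        using P3 psubset(1) H_in[OF psubset(1) g] by (auto simp: P3_def)
      moreover have "(\<Sum>K\<in>{K. K \<subset> J}. H K (H J g) x) = 0" for x
        using below g by (intro sum.neutral) auto
      ultimately show ?thesis
        using 3 by (simp add: sum_Pow_H[OF psubset(1)])
    qed
  qed
qed

section \<open>Independent features\<close>

text \<open>Moebius inversion on the subset lattice, carried out by peeling off the top summand
  inductively.\<close>

lemma H_eq_if_sum_Pow_eq:
  assumes "J \<subseteq> D" "\<And>K. K \<subseteq> J \<Longrightarrow> (\<lambda>x. \<Sum>N\<in>Pow K. H N g x) = (\<lambda>x. \<Sum>N\<in>Pow K. H N h x)"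
  shows "H J g = H J h"
  using assms
proof (induction J rule: subset_induct)
  case (psubset J)
  have "(\<Sum>K\<in>{K. K \<subset> J}. H K g x) = (\<Sum>K\<in>{K. K \<subset> J}. H K h x)" for x
    using psubset(2,3) by (intro sum.cong fun_cong[where f = "H K g" for K]) auto
  then show ?case
    using psubset(3)[of J] by (simp add: sum_Pow_H[OF psubset(1)] fun_eq_iff)
qed

text \<open>Follows the derivation of (P3) from its starred form, with the marginal expectation of
  \<open>g\<close> as the target in place of \<open>g\<close>.\<close>

lemma P6_if_star:
  assumes P2: "P2 D S H" and P3: "P3 D S H" and P6s: "P6_star M X D S L"
  shows "P6 M X D S H"
  unfolding P6_def
proof (intro impI)
  assume ind: "indep_vars (\<lambda>_. borel) X D"
  let ?E = "marg_expect_op M X D S"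
  have "\<forall>g\<in>bmf D S. (\<lambda>x. \<Sum>K\<in>Pow J. H K g x) = ?E J g" if "J \<subseteq> D" for J
    using that
  proof (induction J rule: subset_induct)
    case (psubset J)
    show ?case
    proof (cases "J = {}")
      case True
      then show ?thesis by (simp add: H_empty expect_op_eq_marg)
    next
      case False
      show ?thesis
      proof (intro ballI ext)
        fix g x assume g: "g \<in> bmf D S"
        have Lg: "L J g \<in> bmf_dep D S J" by (rule L_in[OF psubset(1) False g])
        have Eg: "?E J g \<in> bmf_dep D S J" by (rule linear_operatorD(1)[OF linear_marg_expect_op g])
        have V: "L J g \<in> bmf D S" "?E J g \<in> bmf D S" by (rule bmf_dep_in_bmf, fact)+
        \<comment> \<open>By induction the partial sums over \<open>Pow N\<close> are
          \<open>?E N\<close>, which by the tower rule takes the same value on \<open>?E J g\<close>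
          and \<open>g\<close>; inversion passes this on to each \<open>H K\<close>.\<close>
        have HE: "H K (?E J g) = H K g" if "K \<subset> J" for K
        proof (rule H_eq_if_sum_Pow_eq)
          fix N assume "N \<subseteq> K"
          then have N: "N \<subset> J" using that by auto
          then show "(\<lambda>x. \<Sum>K\<in>Pow N. H K (?E J g) x) = (\<lambda>x. \<Sum>K\<in>Pow N. H K g x)"
            using psubset(2)[OF N] V(2) g marg_expect_op_tower[OF ind _ psubset(1) g, of N] by simp
        qed (use that psubset(1) in auto)
        have dz: "deriv_zero D S J (\<lambda>x. L J g x - ?E J g x)"
          using P6s ind psubset(1) False g by (auto simp: P6_star_def)
        have below: "annihilates K" "reproduces K" if "K \<subset> J" for K
          using P2 P3 that psubset(1) by (auto simp: P2_iff P3_iff)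
        have "L J g x - ?E J g x = (\<Sum>K\<in>{K. K \<subset> J}. H K (\<lambda>x. L J g x - ?E J g x) x)"
          by (rule sum_lower_H[OF psubset(1) below bmf_dep_diff[OF Lg Eg] dz, symmetric])
        also have "\<dots> = (\<Sum>K\<in>{K. K \<subset> J}. H K (L J g) x - H K (?E J g) x)"
          using psubset(1)
          by (intro sum.cong fun_cong[OF linear_operator_diff[OF linear_H V]]) auto
        \<comment> \<open>Here the lower terms of the average become those of \<open>g\<close>, as
          needed for the sum over \<open>Pow J\<close>.\<close>
        also have "\<dots> = (\<Sum>K\<in>{K. K \<subset> J}. H K (L J g) x - H K g x)"
          using HE by (intro sum.cong) auto
        finally show "(\<Sum>K\<in>Pow J. H K g x) = ?E J g x"
          unfolding sum_Pow_H[OF psubset(1)] H_nonempty[OF psubset(1) False, of g]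
          by (simp add: sum_subtractf)
      qed
    qed
  qed
  then show "\<forall>J\<subseteq>D. \<forall>g\<in>bmf D S. (\<lambda>x. \<Sum>K\<in>Pow J. H K g x) = ?E J g" by blast
qed

end

section \<open>Assembly of the seven claims\<close>

theorem proposition4:
  fixes M :: "'a measure"
    and d :: nat and D :: "nat set"
    and X :: "nat \<Rightarrow> 'a \<Rightarrow> real"
    and S :: "nat \<Rightarrow> real set"
    and L H :: "nat set \<Rightarrow> rfun \<Rightarrow> rfun"
  assumes "d \<ge> 1" and "D = {1..d}"
    and "prob_space M"
    and "\<And>j. j \<in> D \<Longrightarrow> X j \<in> borel_measurable M"
    and "\<And>j. j \<in> D \<Longrightarrow> compact (S j)"
    and "\<And>j. j \<in> D \<Longrightarrow> S j \<noteq> {}"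
    and "\<And>j. j \<in> D \<Longrightarrow> AE \<omega> in M. X j \<omega> \<in> S j"
    and "\<And>J. J \<subseteq> D \<Longrightarrow> J \<noteq> {} \<Longrightarrow> linear_operator (bmf D S) (bmf_dep D S J) (L J)"
    and "H = H_op M X D S L"
  shows "P1 M X D S H \<and>
    (P2_star D S L \<and> P3_star D S L \<longrightarrow> P2 D S H \<and> P3 D S H) \<and>
    (P2 D S H \<longrightarrow> P2_star D S L) \<and>
    (P3 D S H \<longrightarrow> P3_star D S L) \<and>
    (P2 D S H \<and> P3 D S H \<longrightarrow> P4 D S H \<and> P5 D S H) \<and>
    (P2 D S H \<and> P3 D S H \<and> P6_star M X D S L \<longrightarrow> P6 M X D S H) \<and>
    (P6 M X D S H \<longrightarrow> P6_star M X D S L)"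
proof -
  interpret prob_space M by fact
  interpret functional_decomposition M D X S L
  proof unfold_locales
    show "finite D" using assms(2) by simp
    show "S j \<in> sets borel" if "j \<in> D" for j
      by (rule borel_compact[OF assms(5)[OF that]])
  qed (fact assms(4,6,7,8))+
  let ?H = "H_op M X D S L"
  show ?thesis
    unfolding assms(9)
  proof (intro conjI impI)
    show "P1 M X D S ?H"
      unfolding P1_def
      using expect_H by (simp add: H_empty)
    show "P2 D S ?H" "P3 D S ?H" if "P2_star D S L \<and> P3_star D S L"
      unfolding P2_iff P3_iff
      using star_imp_P2_P3[OF conjunct1[OF that] conjunct2[OF that]] by blast+
    show "P4 D S ?H" "P5 D S ?H" if "P2 D S ?H \<and> P3 D S ?H"
      unfolding P4_def P5_def
      using H_comp_H[OF conjunct1[OF that] conjunct2[OF that]] by simp_all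
  qed (use P2_imp_star P3_imp_star P6_if_star P6_imp_star in blast)+
qed

end
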